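(* Let $n\ge 2$ be an integer and let $F_n$ be the friendship graph, i.e. the graph with $2n+1$ vertices and $3n$ edges obtained from $n$ copies of the triangle $C_3$ by identifying one vertex from each copy into a single common vertex. Then: (i) the Randić characteristic polynomial of $F_n$ is $RP(F_n,\lambda)=\left(\lambda^2-\frac14\right)^{n-1}(\lambda-1)\left(\lambda+\frac12\right)^2$; (ii) the Randić energy of $F_n$ is $RE(F_n)=n+1$.
   Context: All graphs are finite and simple. For a graph $G$ with vertices $v_1,\dots,v_N$ of degrees $d_1,\dots,d_N$, the Randić matrix $R(G)$ is the $N\times N$ real symmetric matrix with $(i,j)$-entry $\frac{1}{\sqrt{d_id_j}}$ if $v_i$ and $v_j$ are adjacent, and $0$ otherwise. The Randić characteristic polynomial of $G$ is $RP(G,\lambda)=\det(\lambda I-R(G))$. The Randić energy of $G$ is $RE(G)=\sum_{i=1}^N|\rho_i|$, where $\rho_1,\dots,\rho_N$ are the eigenvalues of $R(G)$ counted with multiplicity. *)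

theory Defs
  imports Complex_Main "Jordan_Normal_Form.Char_Poly" "Graph_Theory.Pair_Digraph"
begin

text \<open>
  Following the convention of \<^locale>\<open>pair_graph\<close>, a finite simple graph is a finite, loop-free,
  symmetric digraph whose arcs are ordered pairs of vertices: an edge is a pair of opposite arcs,
  and the degree of a vertex is its out-degree.
  The list \<open>vs\<close> is the enumeration of the vertices that indexes rows and columns.
\<close>

definition randic_matrix :: "'v pair_pre_digraph \<Rightarrow> 'v list \<Rightarrow> real mat" where
  "randic_matrix G vs = mat (length vs) (length vs) (\<lambda>(i, j).
     if vs ! i \<rightarrow>\<^bsub>with_proj G\<^esub> vs ! j
     then 1 / sqrt (real (out_degree (with_proj G) (vs ! i)) * real (out_degree (with_proj G) (vs ! j)))
     else 0)"

definition randic_char_poly :: "'v pair_pre_digraph \<Rightarrow> 'v list \<Rightarrow> real poly" where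
  "randic_char_poly G vs = char_poly (randic_matrix G vs)"

text \<open>
  Every eigenvalue of a Randic matrix is real because the matrix is symmetric, so the sum over real
  eigenvalues, weighted by algebraic multiplicity, misses none.
\<close>

definition randic_energy :: "'v pair_pre_digraph \<Rightarrow> 'v list \<Rightarrow> real" where
  "randic_energy G vs = (\<Sum>\<rho> | eigenvalue (randic_matrix G vs) \<rho>.
     real (order \<rho> (randic_char_poly G vs)) * \<bar>\<rho>\<bar>)"

text \<open>The vertices of the \<open>i\<close>-th triangle are \<open>(i, 0)\<close>, \<open>(i, 1)\<close>, \<open>(i, 2)\<close>.\<close>

definition disjoint_triangles :: "nat \<Rightarrow> (nat \<times> nat) pair_pre_digraph" where
  "disjoint_triangles n =
     \<lparr> pverts = {..<n} \<times> {..<3},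
       parcs = {((i, a), (i, b)) | i a b. i < n \<and> a < 3 \<and> b < 3 \<and> a \<noteq> b} \<rparr>"

definition identify_corner :: "nat \<times> nat \<Rightarrow> nat \<times> nat" where
  "identify_corner = (\<lambda>(i, a). if a = 0 then (0, 0) else (i, a))"

definition friendship_graph :: "nat \<Rightarrow> (nat \<times> nat) pair_pre_digraph" where
  "friendship_graph n =
     \<lparr> pverts = identify_corner ` pverts (disjoint_triangles n),
       parcs = map_prod identify_corner identify_corner ` parcs (disjoint_triangles n) \<rparr>"

lemma less_three_iff: "(a::nat) < 3 \<longleftrightarrow> a = 0 \<or> a = 1 \<or> a = 2"
  by auto

lemma pverts_friendship_graph:
  assumes "n \<ge> 1"
  shows "pverts (friendship_graph n) = insert (0, 0) ({..<n} \<times> {1, 2})"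
proof -
  have "identify_corner ` ({..<n} \<times> {..<3})
      = identify_corner ` ({..<n} \<times> {0}) \<union> identify_corner ` ({..<n} \<times> {1, 2})"
    by (subst image_Un [symmetric]) (rule arg_cong [where f = "image identify_corner"], auto)
  also have "identify_corner ` ({..<n} \<times> {0}) = {(0, 0)}"
    using assms by (force simp: identify_corner_def image_iff intro: exI [of _ 0])
  also have "identify_corner ` ({..<n} \<times> {1, 2}) = {..<n} \<times> {1, 2}"
    by (force simp: identify_corner_def image_iff)
  finally show ?thesis
    by (simp add: friendship_graph_def disjoint_triangles_def)
qed

lemma parcs_friendship_graph:
  "parcs (friendship_graph n) =
     (\<lambda>i. ((0, 0), (i, 1))) ` {..<n} \<union> (\<lambda>i. ((0, 0), (i, 2))) ` {..<n} \<union>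
     (\<lambda>i. ((i, 1), (0, 0))) ` {..<n} \<union> (\<lambda>i. ((i, 2), (0, 0))) ` {..<n} \<union>
     (\<lambda>i. ((i, 1), (i, 2))) ` {..<n} \<union> (\<lambda>i. ((i, 2), (i, 1))) ` {..<n}"
proof -
  have "parcs (disjoint_triangles n) =
     (\<lambda>i. ((i, 0), (i, 1))) ` {..<n} \<union> (\<lambda>i. ((i, 0), (i, 2))) ` {..<n} \<union>
     (\<lambda>i. ((i, 1), (i, 0))) ` {..<n} \<union> (\<lambda>i. ((i, 2), (i, 0))) ` {..<n} \<union>
     (\<lambda>i. ((i, 1), (i, 2))) ` {..<n} \<union> (\<lambda>i. ((i, 2), (i, 1))) ` {..<n}"
    by (auto simp: disjoint_triangles_def less_three_iff)
  then show ?thesis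
    by (simp add: friendship_graph_def image_Un image_image identify_corner_def)
qed

lemma pair_graph_friendship_graph:
  assumes "n \<ge> 1"
  shows "pair_graph (friendship_graph n)"
proof
  show "symmetric (with_proj (friendship_graph n))"
    by (auto simp: symmetric_def parcs_friendship_graph intro!: symI)
qed (use assms in \<open>auto simp: pverts_friendship_graph parcs_friendship_graph\<close>)

lemma card_pverts_friendship_graph:
  assumes "n \<ge> 1"
  shows "card (pverts (friendship_graph n)) = 2 * n + 1"
  using assms by (simp add: pverts_friendship_graph card_insert_if)

text \<open>Each of the \<open>3 * n\<close> edges contributes two arcs.\<close>

lemma card_parcs_friendship_graph: "card (parcs (friendship_graph n)) = 2 * (3 * n)"
  unfolding parcs_friendship_graph
  by (subst card_Un_disjoint, simp, simp, force)+ (simp add: card_image inj_on_def)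

end

theory Submission
  imports Defs
begin

text \<open>
  The matrix \<open>R\<close> is conjugate, by the square roots of the degrees, to the transition matrix of the
  simple random walk, so it is enough to diagonalise the latter, that is, to solve
  \<open>\<Sum>\<^bsub>x ~ u\<^esub> f x = \<lambda> * deg u * f u\<close>. On the friendship graph this has the eigenfunctions:
  the constant \<open>1\<close> (eigenvalue \<open>1\<close>); the function that is \<open>-2\<close> at the centre and \<open>1\<close> elsewhere
  (\<open>-1/2\<close>); for each triangle the function with values \<open>1\<close> and \<open>-1\<close> on its two outer vertices
  (\<open>-1/2\<close>); for each triangle but one the difference of its outer indicator function and that of the
  exceptional triangle (\<open>1/2\<close>). Indexing the eigenfunctions by the vertices themselves makes
  the argument independent of the enumeration of the vertices.
\<close>

section \<open>Spectrum and energy from an explicit eigenbasis\<close>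

lemma sum_nth_distinct:
  assumes "distinct xs"
  shows "(\<Sum>i = 0..<length xs. f (xs ! i)) = sum f (set xs)"
  by (simp add: assms sum.distinct_set_conv_list sum_list_sum_nth)

text \<open>Column \<open>w\<close> of \<open>p\<close> is an eigenvector for \<open>d w\<close>,
  and \<open>q\<close> inverts \<open>p\<close>, so the matrix is similar to a diagonal one.
  \<open>M\<close> turns matrix products into sums over \<open>set vs\<close>, which hides the order
  of the enumeration.\<close>

lemma char_poly_eigenbasis:
  fixes r p q :: "'v \<Rightarrow> 'v \<Rightarrow> 'a :: field"
  assumes vs: "distinct vs"
    and eig: "\<And>u w. u \<in> set vs \<Longrightarrow> w \<in> set vs \<Longrightarrow> (\<Sum>x\<in>set vs. r u x * p x w) = p u w * d w"
    and inv: "\<And>u w. u \<in> set vs \<Longrightarrow> w \<in> set vs \<Longrightarrow>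
      (\<Sum>x\<in>set vs. p u x * q x w) = (if u = w then 1 else 0)"
  shows "char_poly (mat (length vs) (length vs) (\<lambda>(i, j). r (vs ! i) (vs ! j)))
    = (\<Prod>u\<in>set vs. [:- d u, 1:])"
proof -
  define N where "N = length vs"
  define M where "M f = mat N N (\<lambda>(i, j). f (vs ! i) (vs ! j))" for f :: "'v \<Rightarrow> 'v \<Rightarrow> 'a"
  define D where "D = M (\<lambda>u w. if u = w then d u else 0)"
  have carrier: "M f \<in> carrier_mat N N" for f
    by (simp add: M_def)
  have mult: "M f * M g = M (\<lambda>u w. \<Sum>x\<in>set vs. f u x * g x w)" for f g
    by (rule eq_matI) (auto simp: M_def scalar_prod_def N_def simp flip: sum_nth_distinct [OF vs])
  have cong: "M f = M g" if "\<And>u w. u \<in> set vs \<Longrightarrow> w \<in> set vs \<Longrightarrow> f u w = g u w" for f g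
    by (rule eq_matI) (auto simp: M_def N_def that)
  have one: "M (\<lambda>u w. if u = w then 1 else 0) = 1\<^sub>m N"
    by (rule eq_matI) (auto simp: M_def N_def nth_eq_iff_index_eq [OF vs])
  have PQ: "M p * M q = 1\<^sub>m N"
    unfolding mult one [symmetric] by (rule cong) (rule inv)
  have QP: "M q * M p = 1\<^sub>m N"
    by (rule mat_mult_left_right_inverse [OF carrier carrier PQ])
  have "M r * M p = M p * D"
    unfolding D_def mult by (rule cong) (simp add: eig if_distrib [where f = "\<lambda>t. _ * t"] cong: if_cong)
  then have "M p * D * M q = M r * (M p * M q)"
    by (metis assoc_mult_mat carrier)
  then have "M r = M p * D * M q"
    using right_mult_one_mat [OF carrier] by (simp add: PQ)
  moreover have "{M r, D, M p, M q} \<subseteq> carrier_mat N N"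
    by (simp add: D_def carrier)
  ultimately have "similar_mat (M r) D"
    using similar_matI PQ QP by blast
  then have "char_poly (M r) = char_poly D"
    by (rule char_poly_similar)
  also have "\<dots> = (\<Prod>a\<leftarrow>diag_mat D. [:- a, 1:])"
    by (rule char_poly_upper_triangular [of _ N])
       (auto simp: D_def M_def N_def nth_eq_iff_index_eq [OF vs])
  also have "diag_mat D = map d vs"
    by (rule nth_equalityI) (auto simp: diag_mat_def D_def M_def N_def)
  also have "(\<Prod>a\<leftarrow>map d vs. [:- a, 1:]) = (\<Prod>u\<in>set vs. [:- d u, 1:])"
    by (simp add: prod.distinct_set_conv_list [OF vs] o_def)
  finally show ?thesis
    by (simp add: M_def N_def)
qed

text \<open>Turns the multiplicities that weight \<open>randic_energy\<close> into sizes of fibres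
  of \<open>d\<close>.\<close>

lemma order_prod_monic_linear:
  fixes d :: "'v \<Rightarrow> 'a :: idom"
  assumes "finite V"
  shows "order \<rho> (\<Prod>u\<in>V. [:- d u, 1:]) = card {u \<in> V. d u = \<rho>}"
  using assms
proof (induction V rule: finite_induct)
  case empty
  show ?case by (simp add: order_0I)
next
  case (insert v V)
  have "order \<rho> [:- d v, 1:] = (if d v = \<rho> then 1 else 0)"
    using order_power_n_n [of \<rho> 1] by (auto intro: order_0I)
  moreover have "{u \<in> insert v V. d u = \<rho>} =
      (if d v = \<rho> then insert v {u \<in> V. d u = \<rho>} else {u \<in> V. d u = \<rho>})"
    by auto
  moreover have "[:- d v, 1:] * (\<Prod>u\<in>V. [:- d u, 1:]) \<noteq> 0"
    using insert.hyps by (simp del: mult_pCons_left)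
  ultimately show ?case
    using insert by (simp add: order_mult del: mult_pCons_left)
qed

text \<open>The eigenvalues are the values of \<open>d\<close>, each with its fibre size as
  multiplicity, so the energy is a sum over \<open>V\<close> grouped by fibres.\<close>

lemma randic_energy_split:
  assumes "finite V" and "randic_char_poly G vs = (\<Prod>u\<in>V. [:- d u, 1:])"
  shows "randic_energy G vs = (\<Sum>u\<in>V. \<bar>d u\<bar>)"
proof -
  have "randic_matrix G vs \<in> carrier_mat (length vs) (length vs)"
    by (simp add: randic_matrix_def)
  from eigenvalue_root_char_poly [OF this]
  have "{\<rho>. eigenvalue (randic_matrix G vs) \<rho>} = d ` V"
    using assms by (auto simp flip: randic_char_poly_def simp: poly_prod)
  then have "randic_energy G vs = (\<Sum>\<rho>\<in>d ` V. real (card {u \<in> V. d u = \<rho>}) * \<bar>\<rho>\<bar>)"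
    unfolding randic_energy_def assms(2) order_prod_monic_linear [OF assms(1)] by simp
  also have "\<dots> = (\<Sum>\<rho>\<in>d ` V. \<Sum>u | u \<in> V \<and> d u = \<rho>. \<bar>d u\<bar>)"
    by (rule sum.cong) simp_all
  also have "\<dots> = (\<Sum>u\<in>V. \<bar>d u\<bar>)"
    by (rule sum.image_gen [OF assms(1), symmetric])
  finally show ?thesis .
qed

text \<open>This carries out the passage to the random walk. The first argument of \<open>p\<close>
  is the index of the eigenfunction; \<open>q x w\<close> is the coefficient of \<open>p x\<close>
  in the indicator function of \<open>w\<close>.\<close>

lemma randic_char_poly_eigenfunctions:
  fixes p q :: "'v \<Rightarrow> 'v \<Rightarrow> real"
  assumes vs: "distinct vs" "set vs = pverts G"
    and deg: "\<And>u. u \<in> pverts G \<Longrightarrow> out_degree (with_proj G) u > 0"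
    and eig: "\<And>u w. u \<in> pverts G \<Longrightarrow> w \<in> pverts G \<Longrightarrow>
      (\<Sum>x | x \<in> pverts G \<and> (u, x) \<in> parcs G. p w x) = d w * real (out_degree (with_proj G) u) * p w u"
    and inv: "\<And>u w. u \<in> pverts G \<Longrightarrow> w \<in> pverts G \<Longrightarrow>
      (\<Sum>x\<in>pverts G. p x u * q x w) = (if u = w then 1 else 0)"
  shows "randic_char_poly G vs = (\<Prod>u\<in>pverts G. [:- d u, 1:])"
proof -
  define t where "t u = sqrt (real (out_degree (with_proj G) u))" for u
  have t: "t u \<noteq> 0" "t u * t u = real (out_degree (with_proj G) u)" if "u \<in> pverts G" for u
    using deg [OF that] by (simp_all add: t_def)
  have fin: "finite (pverts G)"
    by (simp flip: vs(2))
  have "char_poly (mat (length vs) (length vs) (\<lambda>(i, j).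
      if (vs ! i, vs ! j) \<in> parcs G then 1 / (t (vs ! i) * t (vs ! j)) else 0))
    = (\<Prod>u\<in>set vs. [:- d u, 1:])"
  \<comment> \<open>Scaling a walk eigenfunction by \<open>t\<close> gives an eigenvector of the
    Randic matrix; dividing \<open>q\<close> by \<open>t\<close> keeps the two bases dual.\<close>
  proof (rule char_poly_eigenbasis [OF vs(1), unfolded vs(2),
        where r = "\<lambda>u x. if (u, x) \<in> parcs G then 1 / (t u * t x) else 0"
          and p = "\<lambda>x w. t x * p w x" and q = "\<lambda>x w. q x w / t w", folded vs(2)], unfold vs(2))
    fix u w assume uw: "u \<in> pverts G" "w \<in> pverts G"
    have "(\<Sum>x\<in>pverts G. (if (u, x) \<in> parcs G then 1 / (t u * t x) else 0) * (t x * p w x))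
        = (\<Sum>x\<in>pverts G. if (u, x) \<in> parcs G then p w x / t u else 0)"
      using t by (intro sum.cong) auto
    also have "\<dots> = (\<Sum>x | x \<in> pverts G \<and> (u, x) \<in> parcs G. p w x) / t u"
      using fin by (simp add: sum.If_cases sum_divide_distrib Int_def)
    also have "\<dots> = t u * p w u * d w"
      using t [OF uw(1)] by (simp add: eig [OF uw] flip: t(2) [OF uw(1)])
    finally show "(\<Sum>x\<in>pverts G. (if (u, x) \<in> parcs G then 1 / (t u * t x) else 0) * (t x * p w x))
        = t u * p w u * d w" .
    have "(\<Sum>x\<in>pverts G. t u * p x u * (q x w / t w)) = t u / t w * (\<Sum>x\<in>pverts G. p x u * q x w)"
      by (simp add: sum_distrib_left field_simps)
    then show "(\<Sum>x\<in>pverts G. t u * p x u * (q x w / t w)) = (if u = w then 1 else 0)"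
      using t [OF uw(2)] by (auto simp add: inv [OF uw])
  qed
  then show ?thesis
    by (simp add: randic_char_poly_def randic_matrix_def t_def real_sqrt_mult vs(2) cong: if_cong)
qed

section \<open>Neighbourhoods and degrees in the friendship graph\<close>

lemma out_degree_with_proj: "out_degree (with_proj G) u = card {x. (u, x) \<in> parcs G}"
proof -
  have "out_arcs (with_proj G) u = Pair u ` {x. (u, x) \<in> parcs G}"
    by (auto simp: out_arcs_def)
  then show ?thesis
    by (simp add: out_degree_def card_image inj_on_def)
qed

lemma friendship_vertex_cases:
  assumes "n \<ge> 1" and "u \<in> pverts (friendship_graph n)"
  obtains "u = (0, 0)" | i where "i < n" "u = (i, 1)" | i where "i < n" "u = (i, 2)"
  using assms by (auto simp: pverts_friendship_graph)

lemma friendship_neighbours: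
  "{x. ((0, 0), x) \<in> parcs (friendship_graph n)} = {..<n} \<times> {1, 2}"
  "i < n \<Longrightarrow> {x. ((i, 1), x) \<in> parcs (friendship_graph n)} = {(0, 0), (i, 2)}"
  "i < n \<Longrightarrow> {x. ((i, 2), x) \<in> parcs (friendship_graph n)} = {(0, 0), (i, 1)}"
  by (auto simp: parcs_friendship_graph)

lemma friendship_out_degree:
  "out_degree (with_proj (friendship_graph n)) (0, 0) = 2 * n"
  "i < n \<Longrightarrow> out_degree (with_proj (friendship_graph n)) (i, 1) = 2"
  "i < n \<Longrightarrow> out_degree (with_proj (friendship_graph n)) (i, 2) = 2"
  by (simp_all add: out_degree_with_proj friendship_neighbours del: One_nat_def)

lemma sum_pverts_friendship:
  fixes f :: "nat \<times> nat \<Rightarrow> 'a :: comm_monoid_add"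
  assumes "n \<ge> 1"
  shows "sum f (pverts (friendship_graph n)) = f (0, 0) + (\<Sum>i<n. f (i, 1) + f (i, 2))"
  using assms by (simp add: pverts_friendship_graph sum.cartesian_product')

lemma prod_pverts_friendship:
  fixes f :: "nat \<times> nat \<Rightarrow> 'a :: comm_monoid_mult"
  assumes "n \<ge> 1"
  shows "prod f (pverts (friendship_graph n)) = f (0, 0) * (\<Prod>i<n. f (i, 1) * f (i, 2))"
  using assms by (simp add: pverts_friendship_graph prod.cartesian_product')

text \<open>Indexing of the basis: \<open>(0, 0)\<close> stands for the constant,
  \<open>(j, 2)\<close> for the skew function of triangle \<open>j\<close>, and
  \<open>(j, 1)\<close> with \<open>j \<noteq> 0\<close> for the difference with triangle
  \<open>0\<close>, the exceptional one. This leaves \<open>(0, 1)\<close> for the function that is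
  \<open>-2\<close> at the centre.\<close>

definition friendship_eigenvalue :: "nat \<times> nat \<Rightarrow> real" where
  "friendship_eigenvalue = (\<lambda>(j, b). if b = 0 then 1 else if b = 1 \<and> j \<noteq> 0 then 1 / 2 else - 1 / 2)"

definition friendship_eigenfunction :: "nat \<times> nat \<Rightarrow> nat \<times> nat \<Rightarrow> real" where
  "friendship_eigenfunction = (\<lambda>(j, b) (i, a).
     if b = 0 then 1
     else if b = 2 then (if i = j \<and> a \<noteq> 0 then if a = 1 then 1 else - 1 else 0)
     else if j = 0 then (if a = 0 then - 2 else 1)
     else if a = 0 then 0 else of_bool (i = j) - of_bool (i = 0))"

text \<open>
  The dual basis: with \<open>S\<^sub>j\<close> and \<open>A\<^sub>j\<close> the half sum and half difference of the values of \<open>f\<close> on the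
  outer vertices of triangle \<open>j\<close>, \<open>M\<close> the mean of the \<open>S\<^sub>j\<close> and \<open>c\<close> the value at the centre,
  the coefficients of \<open>f\<close> are \<open>(2 * M + c) / 3\<close>, \<open>(M - c) / 3\<close>, \<open>S\<^sub>j - M\<close> and \<open>A\<^sub>j\<close>.
\<close>

definition friendship_coefficient :: "nat \<Rightarrow> nat \<times> nat \<Rightarrow> nat \<times> nat \<Rightarrow> real" where
  "friendship_coefficient n = (\<lambda>(j, b) (i, a).
     if b = 0 then (if a = 0 then 1 / 3 else 1 / (3 * real n))
     else if b = 2 then (if i = j \<and> a \<noteq> 0 then if a = 1 then 1 / 2 else - 1 / 2 else 0)
     else if j = 0 then (if a = 0 then - 1 / 3 else 1 / (6 * real n))
     else if a = 0 then 0 else of_bool (i = j) / 2 - 1 / (2 * real n))"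

lemma friendship_eigenfunction_eq:
  assumes n: "n \<ge> 1" and u: "u \<in> pverts (friendship_graph n)" and w: "w \<in> pverts (friendship_graph n)"
  shows "(\<Sum>x | x \<in> pverts (friendship_graph n) \<and> (u, x) \<in> parcs (friendship_graph n).
           friendship_eigenfunction w x)
    = friendship_eigenvalue w * real (out_degree (with_proj (friendship_graph n)) u)
        * friendship_eigenfunction w u"
proof -
  interpret pair_graph "friendship_graph n"
    by (rule pair_graph_friendship_graph [OF n])
  have nb: "{x. x \<in> pverts (friendship_graph n) \<and> (u, x) \<in> parcs (friendship_graph n)}
      = {x. (u, x) \<in> parcs (friendship_graph n)}"
    using in_arcsD2 by blast
  show ?thesis
    using n u
  proof (cases rule: friendship_vertex_cases)
    case 1
    \<comment> \<open>The sum runs over all outer vertices: skew values cancel within a triangle,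
      differences cancel between triangles \<open>j\<close> and \<open>0\<close>.\<close>
    show ?thesis
      unfolding nb unfolding 1 friendship_neighbours friendship_out_degree using n w
      by (cases rule: friendship_vertex_cases)
         (auto simp: sum.cartesian_product' friendship_eigenfunction_def friendship_eigenvalue_def
            sum.distrib sum_subtractf)
  next
    case (2 i)
    show ?thesis
      unfolding nb unfolding 2(2) friendship_neighbours(2) [OF 2(1)] friendship_out_degree(2) [OF 2(1)] using n w
      by (cases rule: friendship_vertex_cases)
         (auto simp: friendship_eigenfunction_def friendship_eigenvalue_def)
  next
    case (3 i)
    show ?thesis
      unfolding nb unfolding 3(2) friendship_neighbours(3) [OF 3(1)] friendship_out_degree(3) [OF 3(1)] using n w
      by (cases rule: friendship_vertex_cases)
         (auto simp: friendship_eigenfunction_def friendship_eigenvalue_def)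
  qed
qed

lemma friendship_coefficient_inverse:
  assumes n: "n \<ge> 1" and u: "u \<in> pverts (friendship_graph n)" and w: "w \<in> pverts (friendship_graph n)"
  shows "(\<Sum>x\<in>pverts (friendship_graph n). friendship_eigenfunction x u * friendship_coefficient n x w)
    = (if u = w then 1 else 0)"
proof -
  obtain i a where u': "u = (i, a)" "i < n" "a = 0 \<and> i = 0 \<or> a = 1 \<or> a = 2"
    using n u by (cases rule: friendship_vertex_cases) (use n in auto)
  obtain k b where w': "w = (k, b)" "k < n" "b = 0 \<and> k = 0 \<or> b = 1 \<or> b = 2"
    using n w by (cases rule: friendship_vertex_cases) (use n in auto)
  let ?s = "\<lambda>x. friendship_eigenfunction x u * friendship_coefficient n x w"
  \<comment> \<open>The index \<open>(0, 1)\<close> belongs to a different kind of eigenfunction and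
    is treated separately. For outer \<open>u\<close>, only \<open>j = i\<close> contributes if
    \<open>i \<noteq> 0\<close>, while every \<open>j\<close> contributes with a minus sign if
    \<open>i = 0\<close>.\<close>
  have "(\<Sum>j = 1..<n. ?s (j, 1)) = (if a = 0 \<or> b = 0 then 0
      else \<Sum>j = 1..<n. (of_bool (i = j) - of_bool (i = 0)) * (of_bool (k = j) / 2 - 1 / (2 * real n)))"
    by (auto simp: u' w' friendship_eigenfunction_def friendship_coefficient_def)
  also have "\<dots> = (if a = 0 \<or> b = 0 then 0
      else if i = 0 then (real n - 1) / (2 * real n) - of_bool (k \<noteq> 0) / 2
      else of_bool (k = i) / 2 - 1 / (2 * real n))"
  proof -
    have "(\<Sum>j = 1..<n. of_bool (k = j) / 2 - 1 / (2 * real n))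
        = of_bool (k \<noteq> 0) / 2 - (real n - 1) / (2 * real n)"
      using w'(2) n by (auto simp: sum_subtractf of_bool_def if_distrib [where f = "\<lambda>t. t / _"]
          cong: if_cong)
    moreover have "(\<Sum>j = 1..<n. of_bool (i = j) * (of_bool (k = j) / 2 - 1 / (2 * real n)))
        = of_bool (k = i) / 2 - 1 / (2 * real n)" if "i \<noteq> 0"
      using u'(2) that by (simp add: of_bool_def if_distrib [where f = "\<lambda>t. t * _"] cong: if_cong)
    ultimately show ?thesis
      by (auto simp: sum_negf [where f = "\<lambda>j. of_bool (k = j) / 2 - 1 / (2 * real n)", simplified])
  qed
  finally have outer_sym: "(\<Sum>j = 1..<n. ?s (j, 1)) = \<dots>" .
  \<comment> \<open>A skew function vanishes off its own triangle.\<close>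
  have "(\<Sum>j<n. ?s (j, 2)) = (\<Sum>j<n. if i = j then ?s (i, 2) else 0)"
    by (rule sum.cong) (auto simp: u' w' friendship_eigenfunction_def friendship_coefficient_def)
  then have outer_skew: "(\<Sum>j<n. ?s (j, 2)) = ?s (i, 2)"
    using u'(2) by simp
  have "(\<Sum>j<n. ?s (j, 1)) = ?s (0, 1) + (\<Sum>j = 1..<n. ?s (j, 1))"
    using n by (simp add: sum.atLeast_Suc_lessThan flip: atLeast0LessThan)
  then have "(\<Sum>x\<in>pverts (friendship_graph n). ?s x)
      = ?s (0, 0) + (?s (0, 1) + (\<Sum>j = 1..<n. ?s (j, 1)) + ?s (i, 2))"
    by (simp only: sum_pverts_friendship [OF n] sum.distrib outer_skew)
  also have "\<dots> = (if u = w then 1 else 0)"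
    unfolding outer_sym using n u'(3) w'(3)
    by (auto simp: u'(1) w'(1) friendship_eigenfunction_def friendship_coefficient_def field_simps)
  finally show ?thesis .
qed

theorem theorem6:
  fixes n :: nat and vs :: "(nat \<times> nat) list"
  assumes "n \<ge> 2"
    and "distinct vs" and "set vs = pverts (friendship_graph n)"
  shows "randic_char_poly (friendship_graph n) vs =
           ([:0, 1:]\<^sup>2 - [:1 / 4:]) ^ (n - 1) * ([:0, 1:] - [:1:]) * ([:0, 1:] + [:1 / 2:])\<^sup>2 \<and>
         randic_energy (friendship_graph n) vs = real n + 1"
proof -
  have n: "n \<ge> 1" using assms(1) by simp
  obtain m where m: "n = Suc m"
    using n by (cases n) auto
  let ?V = "pverts (friendship_graph n)" and ?d = friendship_eigenvalue
  have split: "randic_char_poly (friendship_graph n) vs = (\<Prod>u\<in>?V. [:- ?d u, 1:])"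
  proof (rule randic_char_poly_eigenfunctions [OF assms(2,3),
        where p = friendship_eigenfunction and q = "friendship_coefficient n"])
    show "out_degree (with_proj (friendship_graph n)) u > 0" if "u \<in> ?V" for u
      using n that by (cases rule: friendship_vertex_cases)
         (use n in \<open>simp_all add: friendship_out_degree del: One_nat_def\<close>)
  qed (rule friendship_eigenfunction_eq [OF n] friendship_coefficient_inverse [OF n]; assumption)+
  \<comment> \<open>Triangle \<open>0\<close> carries the eigenvalue \<open>-1/2\<close> twice; each
    of the other \<open>m = n - 1\<close> triangles carries \<open>1/2\<close> and
    \<open>-1/2\<close>.\<close>
  have "(\<Prod>u\<in>?V. [:- ?d u, 1:])
      = [:- 1, 1:] * ([:1 / 2, 1:] * [:1 / 2, 1:]) * ([:- 1 / 2, 1:] * [:1 / 2, 1:]) ^ m"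
    unfolding prod_pverts_friendship [OF n] unfolding m prod.lessThan_Suc_shift
    by (simp add: friendship_eigenvalue_def del: mult_pCons_left mult_pCons_right)
  also have "\<dots> = ([:0, 1:]\<^sup>2 - [:1 / 4:]) ^ (n - 1) * ([:0, 1:] - [:1:]) * ([:0, 1:] + [:1 / 2:])\<^sup>2"
  proof -
    have "[:- 1 / 2, 1:] * [:1 / 2, 1:] = [:0, 1:]\<^sup>2 - [:1 / 4 :: real:]"
      and "[:- 1, 1:] = [:0, 1:] - [:1 :: real:]" and "[:1 / 2, 1:] = [:0, 1:] + [:1 / 2 :: real:]"
      by (simp_all add: power2_eq_square)
    then show ?thesis
      by (simp only: m diff_Suc_1 power2_eq_square mult_ac)
  qed
  finally have poly: "(\<Prod>u\<in>?V. [:- ?d u, 1:]) = \<dots>" .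
  have "randic_energy (friendship_graph n) vs = (\<Sum>u\<in>?V. \<bar>?d u\<bar>)"
    using split by (rule randic_energy_split [rotated]) (simp flip: assms(3))
  \<comment> \<open>The two eigenvalues indexed by a triangle have absolute value \<open>1/2\<close>
    each, in triangle \<open>0\<close> as well.\<close>
  also have "\<dots> = 1 + (\<Sum>i<n. 1)"
    unfolding sum_pverts_friendship [OF n]
    by (intro arg_cong2 [where f = "(+)"] sum.cong) (auto simp: friendship_eigenvalue_def)
  finally have "randic_energy (friendship_graph n) vs = real n + 1"
    by simp
  with split poly show ?thesis by simp
qed

end
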